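(* Let $p$ be a prime number and let $T_{3p}\langle 3,p\rangle$ be the Toeplitz graph on $\{1,\dots,3p\}$ with generating set $\{3,p\}$. Then $\mathrm{ldim}_{\mathrm{f}}(T_{3p}\langle 3,p\rangle)=1$.
   Context: For a positive integer $n$ and $S\subseteq\{1,\dots,n\}$, the Toeplitz graph $T_n\langle S\rangle$ has vertex set $\{1,2,\dots,n\}$, and distinct vertices $p,q$ are adjacent iff $|p-q|\in S$. For a finite simple graph $G$ with shortest-path distance $d$ (taken to be $\infty$ between different components), and vertices $v,w$, the resolving neighborhood is $\mathcal{R}\{v,w\}=\{u\in V(G): d(u,v)\neq d(u,w)\}$. A local resolving function of $G$ is a map $\zeta:V(G)\to[0,1]$ such that $\sum_{u\in\mathcal{R}\{v,w\}}\zeta(u)\geq 1$ for every edge $vw$ of $G$. The local fractional metric dimension is $\mathrm{ldim}_{\mathrm{f}}(G)=\min\{\sum_{v\in V(G)}\zeta(v): \zeta \text{ a local resolving function of } G\}$.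
   Formalization: The formal theorem assumes the prime p is greater than 3; the claim fails for p = 2 (T_6⟨3,2⟩ contains a 5-cycle, so the dimension exceeds 1) and for p = 3 (T_9⟨3⟩ is three disjoint paths, so the dimension is 3). *)

theory Defs
  imports
    "HOL-Computational_Algebra.Primes"
    "Graph_Theory.Pair_Digraph"
    "Graph_Theory.Shortest_Path"
begin

text \<open>
  A finite simple graph is a \<^locale>\<open>pair_graph\<close>: finite, loop-free, and with
  each edge represented by its two opposite arcs.
\<close>

definition toeplitz_graph :: "nat \<Rightarrow> nat set \<Rightarrow> nat pair_pre_digraph" where
  "toeplitz_graph n S =
     \<lparr> pverts = {1..n},
       parcs = {(p, q). p \<in> {1..n} \<and> q \<in> {1..n} \<and> p \<noteq> q \<and> nat \<bar>int p - int q\<bar> \<in> S} \<rparr>"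

lemma pair_graph_toeplitz_graph: "pair_graph (toeplitz_graph n S)"
proof
  let ?G = "toeplitz_graph n S"
  have "parcs ?G \<subseteq> {1..n} \<times> {1..n}"
    by (auto simp: toeplitz_graph_def)
  then show "finite (parcs ?G)"
    by (rule finite_subset) simp
  have "sym (parcs ?G)"
    by (auto simp: toeplitz_graph_def sym_def abs_minus_commute)
  then show "symmetric (with_proj ?G)"
    by (simp add: symmetric_def)
qed (auto simp: toeplitz_graph_def)

text \<open>
  With unit weights the infimum of the walk costs is the shortest-path distance; it is
  \<open>\<infinity>\<close> between different components.
\<close>

definition graph_dist :: "'a pair_pre_digraph \<Rightarrow> 'a \<Rightarrow> 'a \<Rightarrow> ereal" where
  "graph_dist G u v = wf_digraph.\<mu> (with_proj G) (\<lambda>_. 1) u v"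

definition resolving_nbhd :: "'a pair_pre_digraph \<Rightarrow> 'a \<Rightarrow> 'a \<Rightarrow> 'a set" where
  "resolving_nbhd G v w = {u \<in> pverts G. graph_dist G u v \<noteq> graph_dist G u w}"

definition local_resolving_function :: "'a pair_pre_digraph \<Rightarrow> ('a \<Rightarrow> real) \<Rightarrow> bool" where
  "local_resolving_function G \<zeta> \<longleftrightarrow>
     (\<forall>u \<in> pverts G. \<zeta> u \<in> {0..1}) \<and>
     (\<forall>(v, w) \<in> parcs G. (\<Sum>u \<in> resolving_nbhd G v w. \<zeta> u) \<ge> 1)"

text \<open>
  For a finite simple graph the minimum is attained: the constant function \<open>1\<close> is a local
  resolving function, and the constraints cut out a compact subset of the cube.
\<close>

definition ldim_f :: "'a pair_pre_digraph \<Rightarrow> real" where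
  "ldim_f G = (LEAST s. \<exists>\<zeta>. local_resolving_function G \<zeta> \<and> s = (\<Sum>v \<in> pverts G. \<zeta> v))"

end

theory Submission
  imports Defs
begin

text \<open>
  Since \<open>p > 3\<close> is prime, both \<open>3\<close> and \<open>p\<close> are odd, so the graph is bipartite with parity as
  the colouring. It is connected: each residue class modulo \<open>3\<close> is joined by steps of length
  \<open>3\<close>, and \<open>1, 1 + p, 1 + 2 * p\<close> meet all three classes. In a connected bipartite graph the
  distances from a fixed vertex to the two ends of an edge have different parities, so the
  indicator function of a single vertex is a local resolving function of total weight \<open>1\<close>.
\<close>

lemma (in pair_wf_digraph) awalk_cost_unit: "awalk_cost (\<lambda>_. 1) es = length es"
  by (induction es) auto

text \<open>Each arc flips the colour \<open>c\<close>, so the parity of the number of arcs records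
  whether the two ends agree.\<close>

lemma (in pair_wf_digraph) awalk_two_colouring:
  assumes "awalk u es v" and "\<And>x y. (x, y) \<in> parcs G \<Longrightarrow> c x \<noteq> c y"
  shows "even (length es) \<longleftrightarrow> (c u :: bool) = c v"
  using assms(1)
proof (induction es arbitrary: u)
  case Nil
  then show ?case by (simp add: awalk_Nil_iff)
next
  case (Cons e es)
  then have "e \<in> parcs G" "u = fst e" "awalk (snd e) es v"
    by (simp_all add: awalk_Cons_iff)
  with Cons.IH[of "snd e"] assms(2)[of "fst e" "snd e"] show ?case by auto
qed

text \<open>Reachability and nonnegative weights let a path attain the infimum. Hence the distance
  is finite and equals the length of an actual walk, whose parity the colouring fixes.\<close>

lemma (in pair_fin_digraph) graph_dist_two_colouring:
  assumes "u \<rightarrow>\<^sup>*\<^bsub>with_proj G\<^esub> v" and "\<And>x y. (x, y) \<in> parcs G \<Longrightarrow> c x \<noteq> c y"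
  obtains n :: nat where "graph_dist G u v = ereal n" "even n \<longleftrightarrow> (c u :: bool) = c v"
proof -
  obtain es where "apath u es v" "\<mu> (\<lambda>_. 1) u v = awalk_cost (\<lambda>_. 1) es"
    using min_cost_awalk[OF assms(1), of "\<lambda>_. 1"] by auto
  then show thesis
    using that[of "length es"] awalk_two_colouring[of u es v c] assms(2)
    by (simp add: apath_def graph_dist_def awalk_cost_unit)
qed

text \<open>The indicator of \<open>r\<close> attains the value 1. The matching lower bound needs
  only one edge: its resolving neighbourhood lies inside the vertex set and weights are nonnegative,
  so its constraint already bounds the total weight.\<close>

lemma (in pair_fin_digraph) ldim_f_connected_bipartite:
  assumes "r \<in> pverts G" and "\<And>v. v \<in> pverts G \<Longrightarrow> r \<rightarrow>\<^sup>*\<^bsub>with_proj G\<^esub> v"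
    and colouring: "\<And>x y. (x, y) \<in> parcs G \<Longrightarrow> (c x :: bool) \<noteq> c y"
    and "parcs G \<noteq> {}"
  shows "ldim_f G = 1"
  unfolding ldim_f_def
proof (rule Least_equality)
  let ?\<zeta> = "\<lambda>v. if v = r then 1 else 0 :: real"
  have "r \<in> resolving_nbhd G v w" if vw: "(v, w) \<in> parcs G" for v w
  proof -
    have "v \<in> pverts G" "w \<in> pverts G"
      using vw arc_fst_in_verts arc_snd_in_verts by force+
    then have "r \<rightarrow>\<^sup>*\<^bsub>with_proj G\<^esub> v" "r \<rightarrow>\<^sup>*\<^bsub>with_proj G\<^esub> w"
      using assms(2) by blast+
    \<comment> \<open>Exactly one of \<open>v\<close> and \<open>w\<close> has the colour of
      \<open>r\<close>, so one of \<open>m\<close>, \<open>n\<close> is even and the other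
      odd.\<close>
    obtain m :: nat where "graph_dist G r v = ereal m" "even m \<longleftrightarrow> c r = c v"
      using graph_dist_two_colouring[OF \<open>r \<rightarrow>\<^sup>*\<^bsub>with_proj G\<^esub> v\<close> colouring] .
    moreover obtain n :: nat where "graph_dist G r w = ereal n" "even n \<longleftrightarrow> c r = c w"
      using graph_dist_two_colouring[OF \<open>r \<rightarrow>\<^sup>*\<^bsub>with_proj G\<^esub> w\<close> colouring] .
    moreover have "c v \<noteq> c w" by (rule colouring[OF vw])
    ultimately show ?thesis
      using assms(1) by (auto simp: resolving_nbhd_def)
  qed
  moreover have "finite (resolving_nbhd G v w)" for v w
    using pair_finite_verts by (simp add: resolving_nbhd_def)
  ultimately have "local_resolving_function G ?\<zeta>"
    by (auto simp: local_resolving_function_def)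
  moreover have "1 = (\<Sum>v\<in>pverts G. ?\<zeta> v)"
    using assms(1) pair_finite_verts by simp
  ultimately show "\<exists>\<zeta>. local_resolving_function G \<zeta> \<and> 1 = (\<Sum>v\<in>pverts G. \<zeta> v)"
    by blast
next
  fix s
  assume "\<exists>\<zeta>. local_resolving_function G \<zeta> \<and> s = (\<Sum>v\<in>pverts G. \<zeta> v)"
  then obtain \<zeta> where \<zeta>: "local_resolving_function G \<zeta>" "s = (\<Sum>v\<in>pverts G. \<zeta> v)"
    by blast
  obtain v w where "(v, w) \<in> parcs G"
    using assms(4) by auto
  with \<zeta>(1) have "1 \<le> (\<Sum>u\<in>resolving_nbhd G v w. \<zeta> u)"
    by (auto simp: local_resolving_function_def)
  also have "\<dots> \<le> (\<Sum>u\<in>pverts G. \<zeta> u)"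
    using \<zeta>(1) pair_finite_verts
    by (intro sum_mono2) (auto simp: local_resolving_function_def resolving_nbhd_def)
  finally show "1 \<le> s"
    using \<zeta>(2) by simp
qed

lemma toeplitz_graph_reachable_add_mult:
  assumes "d \<in> S" "1 \<le> u" "u + k * d \<le> n"
  shows "u \<rightarrow>\<^sup>*\<^bsub>with_proj (toeplitz_graph n S)\<^esub> (u + k * d)"
proof -
  interpret pair_graph "toeplitz_graph n S"
    by (rule pair_graph_toeplitz_graph)
  show ?thesis
    using assms(3)
  proof (induction k)
    case 0
    then have "u \<in> pverts (toeplitz_graph n S)"
      using assms(2) by (simp add: toeplitz_graph_def)
    then show ?case by simp
  next
    case (Suc k)
    show ?case
    \<comment> \<open>For \<open>d = 0\<close> the next arc would be a loop, which
      \<open>parcs\<close> excludes, but then the endpoint does not move.\<close>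
    proof (cases "d = 0")
      case True
      then show ?thesis using Suc by simp
    next
      case False
      have "u \<rightarrow>\<^sup>*\<^bsub>with_proj (toeplitz_graph n S)\<^esub> (u + k * d)"
        using Suc by simp
      moreover have "(u + k * d, u + Suc k * d) \<in> parcs (toeplitz_graph n S)"
        using Suc.prems assms False by (auto simp: toeplitz_graph_def)
      ultimately show ?thesis
        by (rule reachable_adj_trans)
    qed
  qed
qed

text \<open>Congruent vertices differ by a multiple of \<open>d\<close>, so steps of length
  \<open>d\<close> lead up from the smaller to the larger without leaving the vertex set; symmetry
  gives the way down.\<close>

lemma toeplitz_graph_reachable_cong:
  assumes "d \<in> S" "u \<in> {1..n}" "v \<in> {1..n}" "u mod d = v mod d"
  shows "u \<rightarrow>\<^sup>*\<^bsub>with_proj (toeplitz_graph n S)\<^esub> v"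
proof -
  interpret pair_graph "toeplitz_graph n S"
    by (rule pair_graph_toeplitz_graph)
  have *: "x \<rightarrow>\<^sup>*\<^bsub>with_proj (toeplitz_graph n S)\<^esub> y"
    if xy: "x \<le> y" "1 \<le> x" "y \<le> n" "x mod d = y mod d" for x y
  proof -
    obtain k where "y = x + d * k"
      using mod_eq_nat2E[OF xy(4) xy(1)] .
    then show ?thesis
      using toeplitz_graph_reachable_add_mult[of d S x k n] assms(1) xy(2,3)
      by (simp add: mult.commute)
  qed
  show ?thesis
  proof (cases "u \<le> v")
    case True
    then show ?thesis using *[of u v] assms by simp
  next
    case False
    then have "v \<rightarrow>\<^sup>*\<^bsub>with_proj (toeplitz_graph n S)\<^esub> u"
      using *[of v u] assms by simp
    then show ?thesis by (rule symmetric_reachable')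
  qed
qed

theorem theorem6:
  fixes p :: nat
  assumes "prime p" and "3 < p"
  shows "ldim_f (toeplitz_graph (3 * p) {3, p}) = 1"
proof -
  let ?G = "toeplitz_graph (3 * p) {3, p}"
  interpret pair_graph ?G
    by (rule pair_graph_toeplitz_graph)
  have "odd p"
    using assms primes_dvd_imp_eq[OF two_is_prime_nat assms(1)] by auto
  have "\<not> 3 dvd p"
    using assms primes_dvd_imp_eq[of 3 p] by auto
  show ?thesis
  proof (rule ldim_f_connected_bipartite[where r = 1 and c = even])
    show "1 \<in> pverts ?G"
      using assms(2) by (simp add: toeplitz_graph_def)
    show "parcs ?G \<noteq> {}"
    proof -
      have "(1, 4) \<in> parcs ?G"
        using assms(2) by (simp add: toeplitz_graph_def)
      then show ?thesis by blast
    qed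
    show "even x \<noteq> even y" if "(x, y) \<in> parcs ?G" for x y
    proof -
      have "nat \<bar>int x - int y\<bar> = 3 \<or> nat \<bar>int x - int y\<bar> = p"
        using that by (simp add: toeplitz_graph_def)
      then have "odd (nat \<bar>int x - int y\<bar>)"
        using \<open>odd p\<close> by (elim disjE) (simp_all only: odd_numeral not_False_eq_True)
      then show ?thesis
        by (auto simp: even_nat_iff)
    qed
    show "1 \<rightarrow>\<^sup>*\<^bsub>with_proj ?G\<^esub> v" if "v \<in> pverts ?G" for v
    proof -
      have v: "v \<in> {1..3 * p}"
        using that by (simp add: toeplitz_graph_def)
      \<comment> \<open>As \<open>p\<close> is invertible modulo 3, \<open>k = 0, 1, 2\<close>
        yields every residue; this is checked over the possible residues of \<open>p\<close> and
        \<open>v\<close>.\<close>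
      have "\<exists>k\<le>2. (1 + k * p) mod 3 = v mod 3"
      proof -
        have "p mod 3 \<noteq> 0"
          using \<open>\<not> 3 dvd p\<close> by (simp add: dvd_eq_mod_eq_0)
        moreover have "p mod 3 < 3" "v mod 3 < 3"
          by simp_all
        ultimately have "p mod 3 \<in> {1, 2}" "v mod 3 \<in> {0, 1, 2}"
          unfolding insert_iff empty_iff by linarith+
        then have "\<exists>k\<in>{0, 1, 2}. (1 + k * (p mod 3)) mod 3 = v mod 3"
          by (elim insertE emptyE) (simp_all only:, simp_all)
        then obtain k where "k \<in> {0, 1, 2}" "(1 + k * (p mod 3)) mod 3 = v mod 3"
          by blast
        moreover have "(1 + k * p) mod 3 = (1 + k * (p mod 3)) mod 3"
          by (metis mod_add_right_eq mod_mult_right_eq)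
        ultimately show ?thesis
          by (intro exI[of _ k]) auto
      qed
      then obtain k where k: "k \<le> 2" "(1 + k * p) mod 3 = v mod 3"
        by blast
      have "k * p \<le> 2 * p"
        using k(1) by simp
      \<comment> \<open>The intermediate vertex must lie in the graph: \<open>1 + 2 * p\<close> fits
        below \<open>3 * p\<close>. From there steps of length 3 reach \<open>v\<close>.\<close>
      then have bound: "1 + k * p \<le> 3 * p"
        using assms(2) by linarith
      then have "1 \<rightarrow>\<^sup>*\<^bsub>with_proj ?G\<^esub> (1 + k * p)"
        by (intro toeplitz_graph_reachable_add_mult) auto
      also have "(1 + k * p) \<rightarrow>\<^sup>*\<^bsub>with_proj ?G\<^esub> v"
        using k(2) v bound by (intro toeplitz_graph_reachable_cong[of 3]) auto
      finally show ?thesis .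
    qed
  qed
qed

end
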